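(* Let $n_1,n_2\in\mathbb C$ and $\alpha_0,\alpha_1,\alpha_2\in\mathbb C$. Suppose that a system of the form $(S)$ (see context), with coefficients $a_1,\dots,a_{10}\in\mathbb C(t)$, has the following Painlevé scheme for some $f_0,f_1\in\mathbb C(t)$: (i) $X=0$ is an accessible singular point of multiplicity $2$, and in the coordinates $(X',Y')=(x,x^2y)$ the point $(X',Y')=(0,-t)$ is an accessible singular point with matrix of linear approximation $f_0\begin{pmatrix}1&0\\ 2\alpha_0&n_1\end{pmatrix}$; (ii) $X=\infty$ is an accessible singular point of multiplicity $2$, and in the coordinates $(X'',Y'')=\left(\frac1x,-\frac{xy+\alpha_2}{x}\right)$ the point $(X'',Y'')=(0,-1)$ is an accessible singular point with matrix of linear approximation $f_1\begin{pmatrix}1&0\\ 2\alpha_1&n_2\end{pmatrix}$. Then the system coincides with $$\begin{aligned}\delta t\frac{dx}{dt}=&-(n_1+2)x^2y+2x^2+2(n_1\alpha_1-2\alpha_2)x-n_1t,\\ \delta t\frac{dy}{dt}=&\,4xy^2-4xy-(2n_1\alpha_1+(n_1-6)\alpha_2)y-2\alpha_2,\end{aligned}$$ where $\delta:=4\alpha_0+2n_1\alpha_1-(n_1+2)\alpha_2$.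
   Context: System $(S)$: for a constant $\alpha_2\in\mathbb C$ and $a_i=a_i(t)\in\mathbb C(t)$, $$\frac{dx}{dt}=a_1x^3y+a_2x^2y+a_5xy+a_7y+\tfrac12\big((3a_1+2a_3)\alpha_2-a_4\big)x^2+\big((a_2+a_9)\alpha_2-a_6\big)x+a_8,$$ $$\frac{dy}{dt}=a_3x^2y^2+a_9xy^2+a_{10}y^2+a_4xy+a_6y+\tfrac12(a_1\alpha_2+a_4)\alpha_2 .$$ It is also polynomial in the coordinates $(x_1,y_1)=(1/x,\,-(xy+\alpha_2)x)$; note $(X'',Y'')=(x_1,x_1^2y_1)$. Multiplicity $2$ (double points resolved by two blow-ups): for system $(S)$, $X=0$ has multiplicity $2$ means that the coefficient of $y$ in $dx/dt$ is divisible by $x^2$ and the coefficient of $y^2$ in $dy/dt$ is divisible by $x$, i.e. $a_5=a_7=a_{10}=0$. Similarly $X=\infty$ has multiplicity $2$ means that, in the coordinates $(x_1,y_1)$, the coefficient of $y_1$ in $dx_1/dt$ is divisible by $x_1^2$ and the coefficient of $y_1^2$ in $dy_1/dt$ is divisible by $x_1$, i.e. $a_1=0$ and $2a_1+a_3=0$. Then, in local coordinates $(U,W)=(X',Y'+t)$, resp. $(U,W)=(X'',Y''+1)$, the system has the form $\frac{dU}{dt}=A(U,W)$, $\frac{dW}{dt}=\frac{B(U,W)}{U}$ with $A,B\in\mathbb C(t)[U,W]$; the point $(U,W)=(0,0)$ is an accessible singular point if $B(0,0)=0$, and its matrix of linear approximation is $M=\begin{pmatrix}M_{11}&0\\ M_{21}&M_{22}\end{pmatrix}$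 with $A(0,0)=M_{11}$ and $B=M_{21}U+M_{22}W+(\text{terms of order}\ge2)$. *)

theory Defs
  imports
    "HOL-Computational_Algebra.Computational_Algebra"
    "Jordan_Normal_Form.Matrix"
begin

type_synonym ratfun = "complex poly fract"

text \<open>
  \<open>K = \<complex>(t)\<close> is \<^typ>\<open>ratfun\<close>. A polynomial in two variables \<open>(u, v)\<close> over \<open>K\<close> is a polynomial
  in \<open>v\<close> whose coefficients are polynomials in \<open>u\<close>; so the coefficient of \<open>u^i v^j\<close> in \<open>R\<close>
  is \<^term>\<open>coeff (coeff R j) i\<close>. The field \<open>K(x, y)\<close> is the field of fractions of \<open>K[x, y]\<close>.
\<close>

type_synonym poly2 = "ratfun poly poly"
type_synonym ratfun2 = "ratfun poly poly fract"

definition const_t :: "complex \<Rightarrow> ratfun" where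
  "const_t c = to_fract [:c:]"

definition var_t :: ratfun where
  "var_t = to_fract [:0, 1:]"

definition pconst :: "ratfun \<Rightarrow> poly2" where
  "pconst k = [:[:k:]:]"

definition pvar1 :: poly2 where
  "pvar1 = [:[:0, 1:]:]"

definition pvar2 :: poly2 where
  "pvar2 = [:0, 1:]"

definition emb :: "ratfun \<Rightarrow> ratfun2" where
  "emb k = to_fract (pconst k)"

definition var_x :: ratfun2 where
  "var_x = to_fract pvar1"

definition var_y :: ratfun2 where
  "var_y = to_fract pvar2"

text \<open>Substitution of \<open>(u, v)\<close> for the two variables of a polynomial over \<open>K\<close>.\<close>

definition eval2 :: "poly2 \<Rightarrow> ratfun2 \<Rightarrow> ratfun2 \<Rightarrow> ratfun2" where
  "eval2 R u v = poly (map_poly (\<lambda>r. poly (map_poly emb r) u) R) v"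

text \<open>
  A system \<open>dx/dt = P, dy/dt = Q\<close> with \<open>P, Q \<in> K[x, y]\<close> determines how every
  \<open>f \<in> K(x, y)\<close> changes along its solutions, namely
  \<open>df/dt = \<partial>f/\<partial>t + P \<partial>f/\<partial>x + Q \<partial>f/\<partial>y\<close>. This total derivative is the unique
  \<open>\<complex>\<close>-linear derivation of \<open>K(x, y)\<close> with the prescribed values on \<open>t\<close>, \<open>x\<close>, \<open>y\<close>;
  existence and uniqueness are proved below. In any other coordinates \<open>(X, Y)\<close>, elements
  of \<open>K(x, y)\<close>, the system reads \<open>dX/dt = \<dots>, dY/dt = \<dots>\<close> with the
  total derivatives of \<open>X\<close> and \<open>Y\<close> on the left.
\<close>

definition is_total_derivative :: "poly2 \<times> poly2 \<Rightarrow> (ratfun2 \<Rightarrow> ratfun2) \<Rightarrow> bool" where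
  "is_total_derivative S D \<longleftrightarrow>
     (\<forall>f g. D (f + g) = D f + D g) \<and>
     (\<forall>f g. D (f * g) = f * D g + g * D f) \<and>
     (\<forall>c. D (emb (const_t c)) = 0) \<and>
     D (emb var_t) = 1 \<and>
     D var_x = eval2 (fst S) var_x var_y \<and>
     D var_y = eval2 (snd S) var_x var_y"

definition total_derivative :: "poly2 \<times> poly2 \<Rightarrow> ratfun2 \<Rightarrow> ratfun2" where
  "total_derivative S = (THE D. is_total_derivative S D)"

definition ring_hom_to :: "('r::idom \<Rightarrow> 'f::field) \<Rightarrow> bool" where
  "ring_hom_to e \<longleftrightarrow> (\<forall>a b. e (a + b) = e a + e b) \<and> (\<forall>a b. e (a * b) = e a * e b) \<and> e 1 = 1"

definition deriv_along :: "('r::idom \<Rightarrow> 'f::field) \<Rightarrow> ('r \<Rightarrow> 'f) \<Rightarrow> bool" where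
  "deriv_along e d \<longleftrightarrow> (\<forall>a b. d (a + b) = d a + d b) \<and> (\<forall>a b. d (a * b) = e a * d b + e b * d a)"

lemma ring_hom_to_0: "ring_hom_to e \<Longrightarrow> e 0 = 0"
  unfolding ring_hom_to_def by (metis add_cancel_right_right)

lemma deriv_along_0: "deriv_along e d \<Longrightarrow> d 0 = 0"
  unfolding deriv_along_def by (metis add_cancel_right_right)

lemma deriv_along_poly_ex:
  fixes e :: "'r::idom poly \<Rightarrow> 'f::field"
  assumes e: "ring_hom_to e" and d: "deriv_along (\<lambda>c. e [:c:]) d"
  shows "\<exists>D. deriv_along e D \<and> (\<forall>c. D [:c:] = d c) \<and> D [:0, 1:] = v"
proof -
  let ?X = "e [:0, 1:]"
  define D where "D p = poly (map_poly d p) ?X + v * e (pderiv p)" for p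
  have d0: "d 0 = 0" using deriv_along_0[OF d] .
  have e0: "e 0 = 0" using ring_hom_to_0[OF e] .
  have ea: "e (p + q) = e p + e q" and em: "e (p * q) = e p * e q" for p q
    using e unfolding ring_hom_to_def by auto
  have da: "d (p + q) = d p + d q" and dm: "d (p * q) = e [:p:] * d q + e [:q:] * d p" for p q
    using d unfolding deriv_along_def by auto
  have mp: "map_poly d (p + q) = map_poly d p + map_poly d q" for p q
    by (rule poly_eqI) (simp add: coeff_map_poly d0 da)
  have add: "D (p + q) = D p + D q" for p q
    by (simp add: D_def mp pderiv_add ea algebra_simps)
  have c: "D [:c:] = d c" for c
    by (cases "c = 0") (simp_all add: D_def map_poly_pCons d0 e0 pderiv_pCons)
  have d1: "d 1 = 0"
  proof -
    have "d 1 = d 1 + d 1"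
      using dm[of 1 1] e unfolding ring_hom_to_def by (simp only: mult_1 flip: one_pCons)
    thus ?thesis by (metis add_cancel_right_right)
  qed
  have X: "D [:0, 1:] = v"
  proof -
    have "e [:1:] = 1" using e unfolding ring_hom_to_def by (simp flip: one_pCons)
    thus ?thesis unfolding D_def by (simp add: map_poly_pCons d0 d1 pderiv_pCons)
  qed
  have pc: "D (pCons 0 q) = ?X * D q + v * e q" for q
  proof -
    have "e (pCons 0 (pderiv q)) = ?X * e (pderiv q)"
      using em[of "[:0,1:]" "pderiv q"] by simp
    thus ?thesis
      by (cases "q = 0") (simp_all add: D_def map_poly_pCons d0 e0 pderiv_pCons ea algebra_simps)
  qed
  have epc: "e (pCons 0 q) = ?X * e q" for q
    using em[of "[:0,1:]" q] by simp
  have sm: "D (Polynomial.smult a q) = e [:a:] * D q + e q * d a" for a q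
  proof (induction q)
    case 0 show ?case by (simp add: D_def e0 d0)
  next
    case (pCons b q)
    have "D (Polynomial.smult a (pCons b q)) = D ([:a * b:] + pCons 0 (Polynomial.smult a q))" by simp
    also have "\<dots> = d (a * b) + (?X * D (Polynomial.smult a q) + v * e (Polynomial.smult a q))"
      by (simp only: add c pc)
    also have "e (Polynomial.smult a q) = e [:a:] * e q" using em[of "[:a:]" q] by simp
    finally have 1: "D (Polynomial.smult a (pCons b q)) =
      d (a * b) + (?X * D (Polynomial.smult a q) + v * (e [:a:] * e q))" .
    have 2: "D (pCons b q) = d b + (?X * D q + v * e q)"
      using add[of "[:b:]" "pCons 0 q"] by (simp add: c pc)
    have 3: "e (pCons b q) = e [:b:] + ?X * e q"
      using ea[of "[:b:]" "pCons 0 q"] by (simp add: epc[of q])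
    show ?case unfolding 1 2 3 pCons.IH dm by (simp add: algebra_simps)
  qed
  have mult: "D (p * q) = e p * D q + e q * D p" for p q
  proof (induction p)
    case 0 show ?case by (simp add: D_def e0)
  next
    case (pCons a p)
    have 1: "D (pCons a p * q) = D (Polynomial.smult a q) + (?X * D (p * q) + v * (e p * e q))"
      by (simp add: add pc em)
    have 2: "D (pCons a p) = d a + (?X * D p + v * e p)"
      using add[of "[:a:]" "pCons 0 p"] by (simp add: c pc)
    have 3: "e (pCons a p) = e [:a:] + ?X * e p"
      using ea[of "[:a:]" "pCons 0 p"] by (simp add: epc[of p])
    show ?case unfolding 1 2 3 pCons.IH sm by (simp add: algebra_simps)
  qed
  show ?thesis using add mult c X unfolding deriv_along_def by blast
qed

lemma fract_cases:
  obtains p q :: "'r::idom" where "q \<noteq> 0" "r = to_fract p / to_fract q"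
  by (cases r) (auto simp: Fract_conv_to_fract)

lemma deriv_along_fract_ex:
  fixes e :: "'r::idom fract \<Rightarrow> 'f::field"
  assumes e: "ring_hom_to e" and d: "deriv_along (\<lambda>c. e (to_fract c)) d"
  shows "\<exists>D. deriv_along e D \<and> (\<forall>c. D (to_fract c) = d c)"
proof -
  have em: "e (p * q) = e p * e q" and ea: "e (p + q) = e p + e q" and e1: "e 1 = 1" for p q
    using e unfolding ring_hom_to_def by auto
  have da: "d (p + q) = d p + d q"
    and dm: "d (p * q) = e (to_fract p) * d q + e (to_fract q) * d p" for p q
    using d unfolding deriv_along_def by auto
  have nz: "e (to_fract q) \<noteq> 0" if "q \<noteq> 0" for q
  proof
    assume "e (to_fract q) = 0"
    moreover have "e (to_fract q * inverse (to_fract q)) = 1" using that by (simp add: e1)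
    ultimately show False by (simp only: em) simp
  qed
  have "\<exists>D. \<forall>r. \<exists>p q. q \<noteq> 0 \<and> r * to_fract q = to_fract p \<and>
     D r = (d p - e r * d q) / e (to_fract q)"
  proof (intro choice allI)
    fix r :: "'r fract"
    obtain p q where "q \<noteq> 0" "r = to_fract p / to_fract q" by (rule fract_cases)
    thus "\<exists>s. \<exists>p q. q \<noteq> 0 \<and> r * to_fract q = to_fract p \<and>
       s = (d p - e r * d q) / e (to_fract q)"
      by (intro exI[of _ "(d p - e r * d q) / e (to_fract q)"] exI[of _ p] exI[of _ q]) simp
  qed
  then obtain D where D: "\<And>r. \<exists>p q. q \<noteq> 0 \<and> r * to_fract q = to_fract p \<and>
     D r = (d p - e r * d q) / e (to_fract q)" by blast
  have key: "D r = (d p - e r * d q) / e (to_fract q)"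
    if q: "q \<noteq> 0" and r: "r * to_fract q = to_fract p" for r p q
  proof -
    obtain p' q' where q': "q' \<noteq> 0" and r': "r * to_fract q' = to_fract p'"
      and Dr: "D r = (d p' - e r * d q') / e (to_fract q')" using D by blast
    have "to_fract (p * q') = to_fract (p' * q)" by (simp add: algebra_simps flip: r r')
    hence "p * q' = p' * q" by (simp only: to_fract_eq_iff)
    hence "d (p * q') = d (p' * q)" by simp
    hence 1: "e (to_fract p) * d q' + e (to_fract q') * d p =
           e (to_fract p') * d q + e (to_fract q) * d p'" by (simp only: dm)
    have 2: "e (to_fract p) = e r * e (to_fract q)" "e (to_fract p') = e r * e (to_fract q')"
      by (simp_all only: em flip: r r')
    have 3: "A / B' = A' / B" if "B \<noteq> 0" "B' \<noteq> 0" "A * B = A' * B'" for A A' B B' :: 'f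
      using that by (simp add: frac_eq_eq)
    have "(d p' - e r * d q') * e (to_fract q) = (d p - e r * d q) * e (to_fract q')"
      using 1 unfolding 2 by (simp add: algebra_simps)
    from 3[OF nz[OF q] nz[OF q'] this] show ?thesis unfolding Dr .
  qed
  have "d 1 = d 1 + d 1" using dm[of 1 1] by (simp only: mult_1 e1 to_fract_1)
  hence one: "d 1 = 0" by (metis add_cancel_right_right)
  have c: "D (to_fract c) = d c" for c
    using key[of 1 "to_fract c" c] by (simp add: e1 one)
  have "D (r + s) = D r + D s \<and> D (r * s) = e r * D s + e s * D r" for r s
  proof -
    obtain p q where q: "q \<noteq> 0" and r: "r = to_fract p / to_fract q" by (rule fract_cases)
    obtain p' q' where q': "q' \<noteq> 0" and s: "s = to_fract p' / to_fract q'" by (rule fract_cases)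
    have r1: "r * to_fract q = to_fract p" and s1: "s * to_fract q' = to_fract p'"
      using r s q q' by simp_all
    have qq: "q * q' \<noteq> 0" using q q' by simp
    have a: "(r + s) * to_fract (q * q') = to_fract (p * q' + p' * q)"
      by (simp add: algebra_simps flip: r1 s1)
    have m: "(r * s) * to_fract (q * q') = to_fract (p * p')"
      by (simp add: algebra_simps flip: r1 s1)
    have 2: "e (to_fract p) = e r * e (to_fract q)" "e (to_fract p') = e s * e (to_fract q')"
      by (simp_all only: em flip: r1 s1)
    note k = key[OF q r1] key[OF q' s1]
    have alg: "((R * Q * d2 + Q' * d1) + (S * Q' * d3 + Q * d4) - (R + S) * (Q * d2 + Q' * d3)) / (Q * Q')
        = (d1 - R * d3) / Q + (d4 - S * d2) / Q'"
      "((R * Q * d4 + S * Q' * d1) - R * S * (Q * d2 + Q' * d3)) / (Q * Q')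
        = R * ((d4 - S * d2) / Q') + S * ((d1 - R * d3) / Q)"
      if "Q \<noteq> 0" "Q' \<noteq> 0" for R S Q Q' d1 d2 d3 d4 :: 'f
    proof -
      define u w where "u = (d1 - R * d3) / Q" and "w = (d4 - S * d2) / Q'"
      have d: "d1 = Q * u + R * d3" "d4 = Q' * w + S * d2"
        using that by (simp_all add: u_def w_def)
      have "(R * Q * d2 + Q' * d1) + (S * Q' * d3 + Q * d4) - (R + S) * (Q * d2 + Q' * d3)
          = (u + w) * (Q * Q')"
        unfolding d by (simp add: algebra_simps)
      moreover have "(R * Q * d4 + S * Q' * d1) - R * S * (Q * d2 + Q' * d3)
          = (R * w + S * u) * (Q * Q')"
        unfolding d by (simp add: algebra_simps)
      ultimately show "((R * Q * d2 + Q' * d1) + (S * Q' * d3 + Q * d4) - (R + S) * (Q * d2 + Q' * d3))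
          / (Q * Q') = (d1 - R * d3) / Q + (d4 - S * d2) / Q'"
        and "((R * Q * d4 + S * Q' * d1) - R * S * (Q * d2 + Q' * d3)) / (Q * Q')
          = R * ((d4 - S * d2) / Q') + S * ((d1 - R * d3) / Q)"
        using that unfolding u_def[symmetric] w_def[symmetric] by simp_all
    qed
    have exp: "d (p * q' + p' * q) = (e r * e (to_fract q) * d q' + e (to_fract q') * d p) +
        (e s * e (to_fract q') * d q + e (to_fract q) * d p')"
      "d (p * p') = e r * e (to_fract q) * d p' + e s * e (to_fract q') * d p"
      "d (q * q') = e (to_fract q) * d q' + e (to_fract q') * d q"
      "e (to_fract (q * q')) = e (to_fract q) * e (to_fract q')"
      by (simp_all only: da dm 2 em to_fract_mult)
    show ?thesis unfolding key[OF qq a] key[OF qq m] k exp ea em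
      using alg[OF nz[OF q] nz[OF q']] by blast
  qed
  thus ?thesis using c unfolding deriv_along_def by blast
qed

lemma emb_simps: "emb (a + b) = emb a + emb b" "emb (a * b) = emb a * emb b"
  "emb 1 = 1" "emb 0 = 0"
  by (simp_all add: emb_def pconst_def flip: to_fract_add to_fract_mult one_pCons)

lemma is_total_derivative_ex: "\<exists>D. is_total_derivative S D"
proof -
  define e1 :: "complex poly \<Rightarrow> ratfun2" where "e1 p = emb (to_fract p)" for p
  define e3 :: "ratfun poly \<Rightarrow> ratfun2" where "e3 p = to_fract [:p:]" for p
  have h1: "ring_hom_to e1" by (simp add: ring_hom_to_def e1_def emb_simps)
  have h2: "ring_hom_to emb" by (simp add: ring_hom_to_def emb_simps)
  have h3: "ring_hom_to e3"
    by (auto simp: ring_hom_to_def e3_def simp flip: to_fract_add to_fract_mult one_pCons)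
  have h4: "ring_hom_to (to_fract :: poly2 \<Rightarrow> ratfun2)" by (simp add: ring_hom_to_def)
  have h5: "ring_hom_to (\<lambda>r. r :: ratfun2)" by (simp add: ring_hom_to_def)
  have "deriv_along (\<lambda>c. e1 [:c:]) (\<lambda>_. 0)" by (simp add: deriv_along_def)
  from deriv_along_poly_ex[OF h1 this, of 1] obtain D1 where
    D1: "deriv_along e1 D1" "\<And>c. D1 [:c:] = 0" "D1 [:0, 1:] = 1" by auto
  have "deriv_along (\<lambda>p. emb (to_fract p)) D1" using D1(1) unfolding e1_def .
  from deriv_along_fract_ex[OF h2 this] obtain D2 where
    D2: "deriv_along emb D2" "\<And>c. D2 (to_fract c) = D1 c" by auto
  have "deriv_along (\<lambda>c. e3 [:c:]) D2" using D2(1) by (simp add: e3_def emb_def[abs_def] pconst_def)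
  from deriv_along_poly_ex[OF h3 this, of "eval2 (fst S) var_x var_y"] obtain D3 where
    D3: "deriv_along e3 D3" "\<And>c. D3 [:c:] = D2 c" "D3 [:0, 1:] = eval2 (fst S) var_x var_y" by auto
  have "deriv_along (\<lambda>c. to_fract [:c:]) D3" using D3(1) by (simp add: e3_def[abs_def])
  from deriv_along_poly_ex[OF h4 this, of "eval2 (snd S) var_x var_y"] obtain D4 where
    D4: "deriv_along to_fract D4" "\<And>c. D4 [:c:] = D3 c" "D4 [:0, 1:] = eval2 (snd S) var_x var_y"
    by auto
  from deriv_along_fract_ex[OF h5 D4(1)] obtain D where
    D: "deriv_along (\<lambda>r. r) D" "\<And>c. D (to_fract c) = D4 c" by auto
  have "is_total_derivative S D"
    using D(1) unfolding is_total_derivative_def deriv_along_def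
    by (simp add: emb_def const_t_def var_t_def var_x_def var_y_def pconst_def pvar1_def pvar2_def
        D(2) D4(2,3) D3(2,3) D2(2) D1(2,3))
  thus ?thesis by blast
qed

lemma deriv_along_poly_unique:
  assumes "ring_hom_to e" "deriv_along e D" "deriv_along e D'"
    and c: "\<And>c. D [:c:] = D' [:c:]" and X: "D [:0, 1:] = D' [:0, 1:]"
  shows "D p = D' p"
proof (induction p)
  case 0 show ?case using deriv_along_0 assms by metis
next
  case (pCons a p)
  have "pCons a p = [:a:] + [:0, 1:] * p" by simp
  thus ?case using assms(2,3) c X pCons.IH unfolding deriv_along_def by metis
qed

lemma deriv_along_fract_unique:
  assumes e: "ring_hom_to e" and "deriv_along e D" "deriv_along e D'"
    and c: "\<And>c. D (to_fract c) = D' (to_fract c)"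
  shows "D r = D' r"
proof -
  obtain p q where q: "q \<noteq> 0" and r: "r = to_fract p / to_fract q" by (rule fract_cases)
  have eq: "to_fract q * r = to_fract p" using q r by simp
  have "e (to_fract q * inverse (to_fract q)) = 1" using q e by (simp add: ring_hom_to_def)
  hence nz: "e (to_fract q) \<noteq> 0" using e unfolding ring_hom_to_def by auto
  have "D (to_fract q * r) = D' (to_fract q * r)" unfolding eq by (rule c)
  hence "e (to_fract q) * D r + e r * D (to_fract q) = e (to_fract q) * D' r + e r * D' (to_fract q)"
    using assms(2,3) unfolding deriv_along_def by metis
  thus ?thesis using nz by (simp add: c)
qed

lemma is_total_derivative_unique:
  assumes "is_total_derivative S D" "is_total_derivative S D'"
  shows "D = D'"
proof
  fix f
  have add: "D (f + g) = D f + D g" "D' (f + g) = D' f + D' g"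
    and mult: "D (f * g) = f * D g + g * D f" "D' (f * g) = f * D' g + g * D' f" for f g
    using assms unfolding is_total_derivative_def by auto
  have val: "D (emb (const_t c)) = D' (emb (const_t c))" "D (emb var_t) = D' (emb var_t)"
    "D var_x = D' var_x" "D var_y = D' var_y" for c
    using assms unfolding is_total_derivative_def by auto
  have along: "deriv_along e (\<lambda>a. D (e a))" "deriv_along e (\<lambda>a. D' (e a))" if "ring_hom_to e"
    for e :: "'r::idom \<Rightarrow> ratfun2"
    using that by (simp_all add: deriv_along_def ring_hom_to_def add mult)
  have h1: "ring_hom_to (\<lambda>p. emb (to_fract p))" by (simp add: ring_hom_to_def emb_simps)
  have h2: "ring_hom_to emb" by (simp add: ring_hom_to_def emb_simps)
  have h3: "ring_hom_to (\<lambda>p :: ratfun poly. to_fract [:p:])"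
    by (auto simp: ring_hom_to_def simp flip: to_fract_add to_fract_mult one_pCons)
  have h4: "ring_hom_to (to_fract :: poly2 \<Rightarrow> ratfun2)" by (simp add: ring_hom_to_def)
  have h5: "ring_hom_to (\<lambda>r. r :: ratfun2)" by (simp add: ring_hom_to_def)
  have 1: "D (emb (to_fract p)) = D' (emb (to_fract p))" for p
    by (rule deriv_along_poly_unique[OF h1 along[OF h1]])
       (use val in \<open>simp_all add: const_t_def var_t_def\<close>)
  have 2: "D (emb k) = D' (emb k)" for k
    by (rule deriv_along_fract_unique[OF h2 along[OF h2]]) (rule 1)
  have 3: "D (to_fract [:p:]) = D' (to_fract [:p:])" for p
    by (rule deriv_along_poly_unique[OF h3 along[OF h3]])
       (use 2 val in \<open>simp_all add: emb_def pconst_def var_x_def pvar1_def\<close>)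
  have 4: "D (to_fract p) = D' (to_fract p)" for p
    by (rule deriv_along_poly_unique[OF h4 along[OF h4]])
       (use 3 val in \<open>simp_all add: var_y_def pvar2_def\<close>)
  show "D f = D' f"
    by (rule deriv_along_fract_unique[OF h5 along[OF h5]]) (rule 4)
qed

lemma is_total_derivative: "is_total_derivative S (total_derivative S)"
  unfolding total_derivative_def
  using is_total_derivative_ex is_total_derivative_unique by (metis the_equality)

text \<open>
  The right-hand sides of \<open>dx/dt\<close> and \<open>dy/dt\<close> in the system \<open>(S)\<close>; only
  \<open>a 1, \<dots>, a 10\<close> occur.
\<close>

definition system_S :: "(nat \<Rightarrow> ratfun) \<Rightarrow> complex \<Rightarrow> poly2 \<times> poly2" where
  "system_S a \<alpha>\<^sub>2 =
    (let x = pvar1; y = pvar2; \<alpha> = const_t \<alpha>\<^sub>2 in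
      (pconst (a 1) * x^3 * y + pconst (a 2) * x^2 * y + pconst (a 5) * x * y + pconst (a 7) * y
         + pconst (((3 * a 1 + 2 * a 3) * \<alpha> - a 4) / 2) * x^2
         + pconst ((a 2 + a 9) * \<alpha> - a 6) * x + pconst (a 8),
       pconst (a 3) * x^2 * y^2 + pconst (a 9) * x * y^2 + pconst (a 10) * y^2
         + pconst (a 4) * x * y + pconst (a 6) * y
         + pconst ((a 1 * \<alpha> + a 4) * \<alpha> / 2)))"

text \<open>
  The system is polynomial in the coordinates \<open>(X, Y)\<close>, and along \<open>X = 0\<close> its
  right-hand sides have the divisibility required for multiplicity 2.
\<close>

definition multiplicity_two :: "poly2 \<times> poly2 \<Rightarrow> ratfun2 \<Rightarrow> ratfun2 \<Rightarrow> bool" where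
  "multiplicity_two S X Y \<longleftrightarrow>
     (\<exists>P Q. total_derivative S X = eval2 P X Y \<and> total_derivative S Y = eval2 Q X Y \<and>
        [:0, 1:]^2 dvd coeff P 1 \<and> [:0, 1:] dvd coeff Q 2)"

definition linear_approximation :: "poly2 \<Rightarrow> poly2 \<Rightarrow> ratfun mat" where
  "linear_approximation A B =
     mat_of_rows_list 2
       [[coeff (coeff A 0) 0, 0],
        [coeff (coeff B 0) 1, coeff (coeff B 1) 0]]"

text \<open>
  The point \<open>(X, Y) = (0, \<eta>)\<close>, where \<open>\<eta> \<in> K\<close> may depend on \<open>t\<close>, is an accessible
  singular point with matrix of linear approximation \<open>M\<close>. The local coordinates are
  \<open>(U, W) = (X, Y - \<eta>)\<close>.
\<close>

definition accessible_singular_point ::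
  "poly2 \<times> poly2 \<Rightarrow> ratfun2 \<Rightarrow> ratfun2 \<Rightarrow> ratfun \<Rightarrow> ratfun mat \<Rightarrow> bool" where
  "accessible_singular_point S X Y \<eta> M \<longleftrightarrow>
     (let U = X; W = Y - emb \<eta> in
      \<exists>A B. total_derivative S U = eval2 A U W \<and> total_derivative S W = eval2 B U W / U \<and>
        coeff (coeff B 0) 0 = 0 \<and> M = linear_approximation A B)"

end

theory Submission
  imports Defs
begin

text \<open>
  In each coordinate system \<open>(U, W)\<close> that occurs, \<open>U\<close> and \<open>W\<close> are algebraically
  independent over \<open>K = \<complex>(t)\<close>. So the polynomials that express the transformed system are
  unique, and they can be computed by substitution and compared with the data of the Painleve
  scheme, coefficient by coefficient. This gives a system of equations for the \<open>a\<^sub>i\<close>, in the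
  following groups.

  The multiplicity at \<open>X = 0\<close> gives directly that
  \<open>a\<^sub>5 = a\<^sub>7 = a\<^sub>1\<^sub>0 = 0\<close>; the multiplicity at \<open>X = \<infinity>\<close>, in the
  coordinates \<open>(x\<^sub>1, y\<^sub>1)\<close>, then gives \<open>a\<^sub>1 = a\<^sub>3 = 0\<close>
  (\<open>multiplicity_two_at_0\<close>, \<open>multiplicity_two_at_infinity\<close>). What remains is the system
  \<open>dx/dt = a\<^sub>2 x\<^sup>2 y + b\<^sub>2 x\<^sup>2 + b\<^sub>1 x + a\<^sub>8\<close>,
  \<open>dy/dt = a\<^sub>9 x y\<^sup>2 + a\<^sub>4 x y + a\<^sub>6 y + c\<close>,
  with \<open>b\<^sub>2\<close>, \<open>b\<^sub>1\<close>, \<open>c\<close> determined by the \<open>a\<^sub>i\<close> and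
  \<open>\<alpha>\<^sub>2\<close>.

  Each accessible singular point gives four equations: the point lies on \<open>B = 0\<close>, and the three
  entries of its matrix (\<open>singular_point_at_0\<close>, \<open>singular_point_at_infinity\<close>). These are
  solved by expressing everything through \<open>a\<^sub>9\<close>. At \<open>0\<close>, the position and the
  diagonal entries give \<open>2 f\<^sub>0 = a\<^sub>9 t\<close>, \<open>4 a\<^sub>2 = - (n\<^sub>1 + 2) a\<^sub>9\<close> and
  \<open>4 a\<^sub>8 = - n\<^sub>1 t a\<^sub>9\<close>; at infinity, the position gives
  \<open>a\<^sub>4 = - a\<^sub>9\<close> and the first column gives \<open>a\<^sub>6\<close>. The last equation, the
  off-diagonal entry at \<open>0\<close>, is the only inhomogeneous one: the coordinate
  \<open>W = x\<^sup>2 y + t\<close> depends explicitly on \<open>t\<close>, which contributes a summand \<open>1\<close>.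
  It becomes \<open>\<delta> t a\<^sub>9 = 4\<close>, and this fixes the overall scale of the system.
\<close>

section \<open>The field \<open>\<complex>(t)\<close> inside \<open>\<complex>(t)(x, y)\<close>\<close>

text \<open>
  The coefficients of the system have the denominator \<open>2\<close>, so \<open>\<complex>(t)\<close> has to be known as
  a field of characteristic \<open>0\<close>.
\<close>

instance fract :: ("{idom, ring_char_0}") field_char_0
proof
  have "of_nat n = (to_fract (of_nat n) :: 'a fract)" for n
    by (induction n) simp_all
  thus "inj (of_nat :: nat \<Rightarrow> 'a fract)"
    by (simp add: inj_on_def)
qed

lemma emb_minus [simp]: "emb (- a) = - emb a"
  by (simp add: emb_def pconst_def flip: to_fract_uminus)

lemma emb_diff [simp]: "emb (a - b) = emb a - emb b"
  using emb_simps(1)[of a "- b"] by simp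

lemma emb_numeral [simp]: "emb (numeral n) = numeral n"
  by (induction n) (simp_all only: emb_simps numeral.simps)

lemma emb_power: "emb (a ^ n) = emb a ^ n"
  by (induction n) (simp_all add: emb_simps)

lemma emb_eq_0_iff [simp]: "emb a = 0 \<longleftrightarrow> a = 0"
  by (simp add: emb_def pconst_def)

lemma const_t_add: "const_t (c + d) = const_t c + const_t d"
  by (simp add: const_t_def flip: to_fract_add)

lemma const_t_diff: "const_t (c - d) = const_t c - const_t d"
  by (simp add: const_t_def flip: to_fract_diff)

lemma const_t_mult: "const_t (c * d) = const_t c * const_t d"
  by (simp add: const_t_def flip: to_fract_mult)

lemma const_t_1: "const_t 1 = 1"
  by (simp add: const_t_def flip: one_pCons)

lemma const_t_numeral: "const_t (numeral n) = numeral n"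
  by (induction n) (simp_all only: const_t_add const_t_1 numeral.simps)

lemmas const_t_simps = const_t_add const_t_diff const_t_mult const_t_1 const_t_numeral

lemma var_x_neq_0 [simp]: "var_x \<noteq> 0"
  by (simp add: var_x_def pvar1_def)

section \<open>Substitution and algebraic independence\<close>

lemma map_poly_emb_pCons [simp]: "map_poly emb (pCons k r) = pCons (emb k) (map_poly emb r)"
  by (simp add: map_poly_pCons emb_simps)

lemma eval2_0 [simp]: "eval2 0 u v = 0"
  by (simp add: eval2_def)

lemma eval2_pCons [simp]:
  "eval2 (pCons r R) u v = poly (map_poly emb r) u + v * eval2 R u v"
  by (simp add: eval2_def map_poly_pCons)

lemma eval2_diff: "eval2 (R - R') u v = eval2 R u v - eval2 R' u v"
proof -
  have inner: "map_poly emb (r - s) = map_poly emb r - map_poly emb s" for r s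
    by (rule poly_eqI) (simp add: coeff_map_poly emb_simps)
  have "map_poly (\<lambda>r. poly (map_poly emb r) u) (R - R') =
      map_poly (\<lambda>r. poly (map_poly emb r) u) R - map_poly (\<lambda>r. poly (map_poly emb r) u) R'"
    by (rule poly_eqI) (simp add: coeff_map_poly inner)
  thus ?thesis by (simp add: eval2_def)
qed

lemma poly_emb_var_x: "poly (map_poly emb r) var_x = to_fract [:r:]"
proof (induction r)
  case (pCons k r)
  have "[:pCons k r:] = pconst k + pvar1 * [:r:]" by (simp add: pconst_def pvar1_def)
  hence "to_fract [:pCons k r:] = emb k + var_x * to_fract [:r:]"
    by (simp add: emb_def var_x_def flip: to_fract_add to_fract_mult)
  thus ?case using pCons.IH by simp
qed simp

text \<open>
  Multiplying \<open>r(1/x)\<close> by \<open>x\<close> to the degree of \<open>r\<close> reverses the list of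
  coefficients of \<open>r\<close>. As \<^const>\<open>reflect_poly\<close> maps only \<open>0\<close> to \<open>0\<close>, no
  information is lost when denominators are cleared in this way.
\<close>

lemma poly_emb_inverse_var_x:
  "var_x ^ degree r * poly (map_poly emb r) (1 / var_x) = to_fract [:reflect_poly r:]"
proof -
  have deg: "degree (map_poly emb r) = degree r"
    by (rule degree_map_poly) simp
  have "reflect_poly (map_poly emb r) = map_poly emb (reflect_poly r)"
    by (rule poly_eqI) (simp add: coeff_reflect_poly coeff_map_poly deg emb_simps)
  thus ?thesis
    using poly_reflect_poly_nz[of var_x "map_poly emb r"]
    by (simp add: deg poly_emb_var_x inverse_eq_divide)
qed

definition alg_independent :: "ratfun2 \<Rightarrow> ratfun2 \<Rightarrow> bool" where
  "alg_independent X Y \<longleftrightarrow> (\<forall>R. eval2 R X Y = 0 \<longrightarrow> R = 0)"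

lemma alg_independentD:
  assumes "alg_independent X Y" "eval2 R X Y = eval2 R' X Y"
  shows "R = R'"
  using assms eval2_diff[of R R' X Y] unfolding alg_independent_def
  by (metis right_minus_eq)

text \<open>
  An element of \<open>K[x][y]\<close> of positive degree in \<open>y\<close> is transcendental over \<open>K[x]\<close>; all
  the independence statements below are reduced to this.
\<close>

lemma pcompose_eq_0_imp:
  fixes R q :: "'r::idom poly"
  assumes "degree q > 0" "pcompose R q = 0"
  shows "R = 0"
proof (rule ccontr)
  assume R: "R \<noteq> 0"
  have "degree R * degree q = 0" using degree_pcompose[of R q] assms by simp
  then obtain c where "R = [:c:]" using assms(1) by (auto elim: degree_eq_zeroE)
  thus False using R assms(2) by simp
qed

lemma alg_independent_var_x:
  assumes "degree q > 0"
  shows "alg_independent var_x (to_fract q)"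
proof -
  have "eval2 R var_x (to_fract q) = to_fract (pcompose R q)" for R
    by (induction R) (simp_all add: poly_emb_var_x pcompose_pCons)
  thus ?thesis using pcompose_eq_0_imp[OF assms] by (simp add: alg_independent_def)
qed

text \<open>
  The coordinates at \<open>X = \<infinity>\<close> have the form \<open>X = 1/x\<close>, \<open>Y = q / x\<^sup>k\<close> with
  \<open>q\<close> of positive degree in \<open>y\<close>. For a polynomial \<open>R\<close>, a large power of \<open>x\<close>
  clears the denominators of \<open>R(X, Y)\<close> and turns it into \<open>R'(q)\<close>, where \<open>R'\<close> is a
  polynomial over \<open>K[x]\<close> whose coefficients are the reflected coefficients of \<open>R\<close> times
  powers of \<open>x\<close>.
\<close>

lemma alg_independent_inverse_var_x:
  assumes q: "degree q > 0" and Y: "var_x ^ k * Y = to_fract q"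
  shows "alg_independent (1 / var_x) Y"
proof -
  have x: "to_fract [:[:0, 1:]:] = var_x" by (simp add: var_x_def pvar1_def)
  have xn: "to_fract [:[:0, 1:] ^ n:] = var_x ^ n" for n
  proof (induction n)
    case (Suc n)
    have "[:[:0, 1:] ^ Suc n:] = [:[:0, 1:]:] * [:[:0, 1 :: ratfun:] ^ n:]" by simp
    thus ?case by (simp only: to_fract_mult x Suc.IH power_Suc)
  qed (simp flip: one_pCons)
  have "\<exists>m R'. (R' = 0 \<longrightarrow> R = 0) \<and> var_x ^ m * eval2 R (1 / var_x) Y = to_fract (pcompose R' q)" for R
  proof (induction R)
    case 0
    show ?case by (intro exI[of _ 0]) simp
  next
    case (pCons r R)
    then obtain m R' where R': "R' = 0 \<Longrightarrow> R = 0"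
      and eq: "var_x ^ m * eval2 R (1 / var_x) Y = to_fract (pcompose R' q)" by blast
    define d where "d = degree r"
    define s where "s = [:0, 1:] ^ (m + k) * reflect_poly r"
    define R'' where "R'' = pCons s (Polynomial.smult ([:0, 1:] ^ d) R')"
    have s: "to_fract [:s:] = var_x ^ (m + k) * (var_x ^ d * poly (map_poly emb r) (1 / var_x))"
      unfolding d_def poly_emb_inverse_var_x s_def by (simp flip: xn to_fract_mult)
    have "to_fract (pcompose R'' q) =
        to_fract [:s:] + to_fract q * (to_fract [:[:0, 1:] ^ d:] * to_fract (pcompose R' q))"
      by (simp add: R''_def pcompose_pCons pcompose_smult flip: to_fract_mult to_fract_add)
    also have "\<dots> = var_x ^ (m + k + d) * eval2 (pCons r R) (1 / var_x) Y"
      unfolding s xn Y[symmetric] eq[symmetric] by (simp add: algebra_simps power_add)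
    finally have "var_x ^ (m + k + d) * eval2 (pCons r R) (1 / var_x) Y = to_fract (pcompose R'' q)" ..
    moreover have "R'' = 0 \<longrightarrow> pCons r R = 0"
      using R' by (auto simp: R''_def s_def)
    ultimately show ?case by blast
  qed
  thus ?thesis
    using pcompose_eq_0_imp[OF q] unfolding alg_independent_def
    by (metis mult_zero_right to_fract_eq_0_iff)
qed

section \<open>Rules of differentiation\<close>

context
  fixes S D
  assumes D: "is_total_derivative S D"
begin

lemma total_derivative_add: "D (f + g) = D f + D g"
  and total_derivative_mult: "D (f * g) = f * D g + g * D f"
  and total_derivative_const: "D (emb (const_t c)) = 0"
  and total_derivative_t: "D (emb var_t) = 1"
  and total_derivative_x: "D var_x = eval2 (fst S) var_x var_y"
  and total_derivative_y: "D var_y = eval2 (snd S) var_x var_y"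
  using D by (simp_all add: is_total_derivative_def)

lemma total_derivative_1: "D 1 = 0"
  using total_derivative_const[of 1] by (simp add: const_t_1 emb_simps)

lemma total_derivative_0: "D 0 = 0"
  using total_derivative_const[of 0] by (simp add: const_t_def emb_simps)

lemma total_derivative_minus: "D (- f) = - D f"
  using total_derivative_add[of f "- f"] total_derivative_0 by (simp add: eq_neg_iff_add_eq_0 add.commute)

lemma total_derivative_diff: "D (f - g) = D f - D g"
  using total_derivative_add[of f "- g"] total_derivative_minus by simp

lemma total_derivative_inverse:
  assumes "f \<noteq> 0"
  shows "D (1 / f) = - D f / f ^ 2"
proof -
  have "f * D (1 / f) + 1 / f * D f = 0"
    using total_derivative_mult[of f "1 / f"] assms total_derivative_1 by simp
  thus ?thesis using assms by (simp add: field_simps power2_eq_square eq_neg_iff_add_eq_0)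
qed

end

section \<open>Double points at zero and at infinity\<close>

lemma system_S_eq:
  assumes "S = system_S a \<alpha>\<^sub>2"
    and "b\<^sub>2 = ((3 * a 1 + 2 * a 3) * const_t \<alpha>\<^sub>2 - a 4) / 2"
    and "b\<^sub>1 = (a 2 + a 9) * const_t \<alpha>\<^sub>2 - a 6"
    and "c = (a 1 * const_t \<alpha>\<^sub>2 + a 4) * const_t \<alpha>\<^sub>2 / 2"
  shows "fst S = [: [:a 8, b\<^sub>1, b\<^sub>2:], [:a 7, a 5, a 2, a 1:] :]"
    and "snd S = [: [:c:], [:a 6, a 4:], [:a 10, a 9, a 3:] :]"
  by (simp_all add: assms system_S_def Let_def pconst_def pvar1_def pvar2_def
      power2_eq_square power3_eq_cube)

lemma multiplicity_two_at_0:
  assumes "S = system_S a \<alpha>\<^sub>2" and "multiplicity_two S var_x var_y"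
  shows "a 5 = 0" "a 7 = 0" "a 10 = 0"
proof -
  note S = system_S_eq[OF assms(1) refl refl refl]
  have D: "is_total_derivative S (total_derivative S)" by (rule is_total_derivative)
  have indep: "alg_independent var_x var_y"
    unfolding var_y_def by (rule alg_independent_var_x) (simp add: pvar2_def)
  obtain P Q where "eval2 (fst S) var_x var_y = eval2 P var_x var_y"
    and "eval2 (snd S) var_x var_y = eval2 Q var_x var_y"
    and dvd: "[:0, 1:]^2 dvd coeff P 1" "[:0, 1:] dvd coeff Q 2"
    using assms(2) unfolding multiplicity_two_def total_derivative_x[OF D] total_derivative_y[OF D] by blast
  hence PQ: "P = fst S" "Q = snd S" using alg_independentD[OF indep] by metis+
  from dvd(1) have "[:0, 1:]^2 dvd [:a 7, a 5, a 2, a 1:]" by (simp add: PQ S)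
  thus "a 5 = 0" "a 7 = 0"
    by (auto simp: power2_eq_square dvd_def mult_pCons_left)
  from dvd(2) have "[:0, 1:] dvd [:a 10, a 9, a 3:]" by (simp add: PQ S numeral_2_eq_2)
  thus "a 10 = 0" by (auto simp: dvd_def)
qed

text \<open>
  The special form of the system makes all poles along \<open>x\<^sub>1 = 0\<close> cancel in the coordinates
  \<open>(x\<^sub>1, y\<^sub>1)\<close>. Given the double point at \<open>X = 0\<close>, in the resulting polynomials the coefficient of \<open>y\<^sub>1\<close> in
  \<open>dx\<^sub>1/dt\<close> is \<open>a\<^sub>1 x\<^sub>1 + a\<^sub>2 x\<^sub>1\<^sup>2\<close>, and that of
  \<open>y\<^sub>1\<^sup>2\<close> in \<open>dy\<^sub>1/dt\<close> is
  \<open>- (2 a\<^sub>1 + a\<^sub>3) - (2 a\<^sub>2 + a\<^sub>9) x\<^sub>1\<close>.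
\<close>

lemma multiplicity_two_at_infinity:
  assumes S: "S = system_S a \<alpha>\<^sub>2" and a: "a 5 = 0" "a 7 = 0" "a 10 = 0"
    and "multiplicity_two S (1 / var_x) (- (var_x * var_y + emb (const_t \<alpha>\<^sub>2)) * var_x)"
  shows "a 1 = 0" "a 3 = 0"
proof -
  define \<alpha> where "\<alpha> = const_t \<alpha>\<^sub>2"
  define b\<^sub>2 where "b\<^sub>2 = ((3 * a 1 + 2 * a 3) * \<alpha> - a 4) / 2"
  define b\<^sub>1 where "b\<^sub>1 = (a 2 + a 9) * \<alpha> - a 6"
  define c where "c = (a 1 * \<alpha> + a 4) * \<alpha> / 2"
  note eq = system_S_eq[OF S b\<^sub>2_def[unfolded \<alpha>_def] b\<^sub>1_def[unfolded \<alpha>_def] c_def[unfolded \<alpha>_def], unfolded a]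
  \<comment> \<open>Written in terms of \<open>b\<^sub>1\<close> and \<open>b\<^sub>2\<close>, the other coefficients have no denominators, and the
    cancellation of the poles becomes a polynomial identity.\<close>
  have a4: "a 4 = (3 * a 1 + 2 * a 3) * \<alpha> - 2 * b\<^sub>2" and a6: "a 6 = (a 2 + a 9) * \<alpha> - b\<^sub>1"
    by (simp_all add: b\<^sub>2_def b\<^sub>1_def field_simps)
  have c: "c = (2 * a 1 + a 3) * \<alpha> ^ 2 - b\<^sub>2 * \<alpha>"
    unfolding c_def a4 by (simp add: field_simps power2_eq_square)
  define D where "D = total_derivative S"
  have D: "is_total_derivative S D" unfolding D_def by (rule is_total_derivative)
  define X Y where "X = 1 / var_x" and "Y = - (var_x * var_y + emb \<alpha>) * var_x"
  have "var_x ^ 0 * Y = to_fract [: [:0, - \<alpha>:], [:0, 0, - 1:] :]"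
  proof -
    have "[: [:0, - \<alpha>:], [:0, 0, - 1:] :] = - (pvar1 * pvar2 + pconst \<alpha>) * pvar1"
      by (simp add: pvar1_def pvar2_def pconst_def)
    thus ?thesis by (simp add: Y_def var_x_def var_y_def emb_def)
  qed
  from alg_independent_inverse_var_x[OF _ this]
  have indep: "alg_independent X Y" by (simp add: X_def)
  let ?P = "[: [:a 1 * \<alpha> - b\<^sub>2, a 2 * \<alpha> - b\<^sub>1, - a 8:], [:0, a 1, a 2:] :]"
  let ?Q = "[: [:\<alpha> * a 8:], [:- 3 * a 2 * \<alpha> + 2 * b\<^sub>1 - 2 * a 9 * \<alpha> + a 6, 2 * a 8:],
      [:- 2 * a 1 - a 3, - 2 * a 2 - a 9:] :]"
  have Dx: "D var_x = emb (a 8) + emb b\<^sub>1 * var_x + emb b\<^sub>2 * var_x ^ 2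
      + (emb (a 2) * var_x ^ 2 + emb (a 1) * var_x ^ 3) * var_y"
    unfolding total_derivative_x[OF D] eq by (simp add: emb_simps algebra_simps power2_eq_square power3_eq_cube)
  have Dy: "D var_y = emb c + (emb (a 6) + emb (a 4) * var_x) * var_y
      + (emb (a 9) * var_x + emb (a 3) * var_x ^ 2) * var_y ^ 2"
    unfolding total_derivative_y[OF D] eq by (simp add: emb_simps algebra_simps power2_eq_square power3_eq_cube)
  have P: "D X = eval2 ?P X Y"
    unfolding X_def Y_def total_derivative_inverse[OF D var_x_neq_0] Dx
    by (simp add: emb_simps field_simps power2_eq_square power3_eq_cube)
  have Q: "D Y = eval2 ?Q X Y"
    unfolding X_def Y_def total_derivative_mult[OF D] total_derivative_minus[OF D] total_derivative_add[OF D] total_derivative_const[OF D] \<alpha>_def Dx Dy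
    unfolding a4 a6 c \<alpha>_def
    by (simp add: emb_simps emb_power field_simps power2_eq_square power3_eq_cube)
  obtain P Q where "D X = eval2 P X Y" and "D Y = eval2 Q X Y"
    and dvd: "[:0, 1:]^2 dvd coeff P 1" "[:0, 1:] dvd coeff Q 2"
    using assms(5) unfolding multiplicity_two_def D_def X_def Y_def \<alpha>_def by blast
  hence PQ: "P = ?P" "Q = ?Q" using alg_independentD[OF indep] P Q by metis+
  from dvd(1) have "[:0, 1:]^2 dvd [:0, a 1, a 2:]" by (simp add: PQ)
  thus a1: "a 1 = 0"
    by (auto simp: power2_eq_square dvd_def)
  from dvd(2) have "[:0, 1:] dvd [:- 2 * a 1 - a 3, - 2 * a 2 - a 9:]"
    by (simp add: PQ numeral_2_eq_2)
  thus "a 3 = 0" by (auto simp: dvd_def a1[simplified])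
qed


section \<open>Accessible singular points\<close>

lemma linear_approximation_eqD:
  assumes "f \<cdot>\<^sub>m mat_of_rows_list 2 [[1, 0], [m, n]] = linear_approximation A B"
  shows "coeff (coeff A 0) 0 = f" "coeff (coeff B 0) 1 = f * m" "coeff (coeff B 1) 0 = f * n"
proof -
  have "(f \<cdot>\<^sub>m mat_of_rows_list 2 [[1, 0], [m, n]]) $$ (i, j) = linear_approximation A B $$ (i, j)" for i j
    using assms by simp
  from this[of 0 0] this[of 1 0] this[of 1 1] show
    "coeff (coeff A 0) 0 = f" "coeff (coeff B 0) 1 = f * m" "coeff (coeff B 1) 0 = f * n"
    by (simp_all add: linear_approximation_def mat_of_rows_list_def)
qed

text \<open>
  Because of the independence of the local coordinates, any \<open>A\<close> and \<open>B\<close> that express the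
  system are the ones that the definition of an accessible singular point speaks of. Stating the
  second equation as \<open>U dW/dt = B\<close> avoids the division.
\<close>

lemma accessible_singular_pointD:
  assumes point: "accessible_singular_point S X Y \<eta> (f \<cdot>\<^sub>m mat_of_rows_list 2 [[1, 0], [m, n]])"
    and D: "is_total_derivative S D"
    and indep: "alg_independent X (Y - emb \<eta>)"
    and A: "D X = eval2 A X (Y - emb \<eta>)" and B: "X * D (Y - emb \<eta>) = eval2 B X (Y - emb \<eta>)"
  shows "coeff (coeff B 0) 0 = 0"
    "coeff (coeff A 0) 0 = f" "coeff (coeff B 0) 1 = f * m" "coeff (coeff B 1) 0 = f * n"
proof -
  have D_eq: "total_derivative S = D"
    using D is_total_derivative is_total_derivative_unique by blast
  obtain A' B' where A': "D X = eval2 A' X (Y - emb \<eta>)"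
    and B': "D (Y - emb \<eta>) = eval2 B' X (Y - emb \<eta>) / X"
    and point: "coeff (coeff B' 0) 0 = 0"
      "f \<cdot>\<^sub>m mat_of_rows_list 2 [[1, 0], [m, n]] = linear_approximation A' B'"
    using point unfolding accessible_singular_point_def D_eq Let_def by blast
  have "X \<noteq> 0"
  proof
    assume "X = 0"
    hence "eval2 [:[:0, 1:]:] X (Y - emb \<eta>) = 0" by (simp add: emb_simps)
    thus False using indep unfolding alg_independent_def by fastforce
  qed
  hence "eval2 B' X (Y - emb \<eta>) = eval2 B X (Y - emb \<eta>)" using B B' by simp
  hence "A' = A" "B' = B" using alg_independentD[OF indep] A A' by metis+
  thus "coeff (coeff B 0) 0 = 0"
    "coeff (coeff A 0) 0 = f" "coeff (coeff B 0) 1 = f * m" "coeff (coeff B 1) 0 = f * n"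
    using point(1) linear_approximation_eqD[OF point(2)] by simp_all
qed

text \<open>
  The local coordinate is \<open>W = x\<^sup>2 y + t\<close>. The summand \<open>1\<close> in the third equation is its
  explicit derivative with respect to \<open>t\<close>.
\<close>

lemma singular_point_at_0:
  assumes S: "fst S = [: [:a8, b\<^sub>1, b\<^sub>2:], [:0, 0, a2:] :]"
      "snd S = [: [:c:], [:a6, a4:], [:0, a9:] :]"
    and point: "accessible_singular_point S var_x (var_x^2 * var_y) (- var_t)
      (f \<cdot>\<^sub>m mat_of_rows_list 2 [[1, 0], [m, n]])"
  shows "(2 * a2 + a9) * var_t\<^sup>2 = 2 * var_t * a8" "a8 - a2 * var_t = f"
    "1 - var_t * (2 * b\<^sub>1 + a6) = f * m" "2 * a8 - 2 * var_t * (2 * a2 + a9) = f * n"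
proof -
  define D where "D = total_derivative S"
  have D: "is_total_derivative S D" unfolding D_def by (rule is_total_derivative)
  define W where "W = var_x^2 * var_y - emb (- var_t)"
  have "W = to_fract [: [:var_t:], [:0, 0, 1:] :]"
  proof -
    have "[: [:var_t:], [:0, 0, 1:] :] = pvar1^2 * pvar2 + pconst var_t"
      by (simp add: pvar1_def pvar2_def pconst_def power2_eq_square)
    thus ?thesis unfolding W_def emb_minus
      by (simp add: var_x_def var_y_def emb_def power2_eq_square)
  qed
  hence indep: "alg_independent var_x W" by (simp add: alg_independent_var_x)
  let ?A = "[: [:a8 - a2 * var_t, b\<^sub>1, b\<^sub>2:], [:a2:] :]"
  let ?B = "[: [:(2 * a2 + a9) * var_t\<^sup>2 - 2 * var_t * a8, 1 - var_t * (2 * b\<^sub>1 + a6),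
        - var_t * (2 * b\<^sub>2 + a4), c:],
      [:2 * a8 - 2 * var_t * (2 * a2 + a9), 2 * b\<^sub>1 + a6, 2 * b\<^sub>2 + a4:], [:2 * a2 + a9:] :]"
  have Dx: "D var_x = emb a8 + emb b\<^sub>1 * var_x + emb b\<^sub>2 * var_x ^ 2 + emb a2 * var_x ^ 2 * var_y"
    unfolding total_derivative_x[OF D] S by (simp add: emb_simps algebra_simps power2_eq_square)
  have Dy: "D var_y = emb c + (emb a6 + emb a4 * var_x) * var_y + emb a9 * var_x * var_y ^ 2"
    unfolding total_derivative_y[OF D] S by (simp add: emb_simps algebra_simps power2_eq_square)
  have A: "D var_x = eval2 ?A var_x W"
    unfolding Dx W_def by (simp add: emb_simps algebra_simps power2_eq_square)
  have B: "var_x * D W = eval2 ?B var_x W"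
    unfolding W_def total_derivative_diff[OF D] emb_minus total_derivative_minus[OF D] total_derivative_t[OF D] power2_eq_square total_derivative_mult[OF D] Dx Dy
    by (simp add: emb_simps algebra_simps power2_eq_square)
  note res = accessible_singular_pointD[OF point D, folded W_def, OF indep A B]
  from res show "(2 * a2 + a9) * var_t\<^sup>2 = 2 * var_t * a8" "a8 - a2 * var_t = f"
    "1 - var_t * (2 * b\<^sub>1 + a6) = f * m" "2 * a8 - 2 * var_t * (2 * a2 + a9) = f * n"
    by simp_all
qed

text \<open>
  The local coordinates are \<open>U = 1/x\<close> and \<open>W = 1 - y - \<alpha>\<^sub>2 U\<close>, so
  \<open>U dW/dt = - U dy/dt - \<alpha>\<^sub>2 U dU/dt\<close>. In it, \<open>U dy/dt\<close> is polynomial because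
  \<open>x U = 1\<close> and \<open>y = 1 - W - \<alpha>\<^sub>2 U\<close>.
\<close>

lemma singular_point_at_infinity:
  assumes S: "fst S = [: [:a8, b\<^sub>1, b\<^sub>2:], [:0, 0, a2:] :]"
      "snd S = [: [:c:], [:a6, a4:], [:0, a9:] :]"
    and point: "accessible_singular_point S (1 / var_x)
      (- ((var_x * var_y + emb (const_t \<alpha>\<^sub>2)) / var_x)) (- 1)
      (f \<cdot>\<^sub>m mat_of_rows_list 2 [[1, 0], [m, n]])"
  shows "a9 + a4 = 0" "- a2 - b\<^sub>2 = f"
    "(2 * a9 + a4 + a2 + b\<^sub>2) * const_t \<alpha>\<^sub>2 - a6 - c = f * m" "2 * a9 + a4 = f * n"
proof -
  define \<alpha> where "\<alpha> = const_t \<alpha>\<^sub>2"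
  define D where "D = total_derivative S"
  have D: "is_total_derivative S D" unfolding D_def by (rule is_total_derivative)
  define X W where "X = 1 / var_x" and "W = - ((var_x * var_y + emb \<alpha>) / var_x) - emb (- 1)"
  have "var_x ^ 1 * W = to_fract [: [:- \<alpha>, 1:], [:0, - 1:] :]"
  proof -
    have "[: [:- \<alpha>, 1:], [:0, - 1:] :] = pvar1 - pvar1 * pvar2 - pconst \<alpha>"
      by (simp add: pvar1_def pvar2_def pconst_def)
    hence "to_fract [: [:- \<alpha>, 1:], [:0, - 1:] :] = var_x - var_x * var_y - emb \<alpha>"
      by (simp add: var_x_def var_y_def emb_def)
    thus ?thesis by (simp add: W_def right_diff_distrib emb_simps)
  qed
  from alg_independent_inverse_var_x[OF _ this]
  have indep: "alg_independent X W" by (simp add: X_def)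
  let ?A = "[: [:- a2 - b\<^sub>2, a2 * \<alpha> - b\<^sub>1, - a8:], [:a2:] :]"
  let ?B = "[: [:- a9 - a4, (2 * a9 + a4 + a2 + b\<^sub>2) * \<alpha> - a6 - c,
        - a9 * \<alpha>^2 + a6 * \<alpha> - a2 * \<alpha>^2 + b\<^sub>1 * \<alpha>, a8 * \<alpha>:],
      [:2 * a9 + a4, a6 - 2 * a9 * \<alpha> - a2 * \<alpha>:], [:- a9:] :]"
  have Dx: "D var_x = emb a8 + emb b\<^sub>1 * var_x + emb b\<^sub>2 * var_x ^ 2 + emb a2 * var_x ^ 2 * var_y"
    unfolding total_derivative_x[OF D] S by (simp add: emb_simps algebra_simps power2_eq_square)
  have Dy: "D var_y = emb c + (emb a6 + emb a4 * var_x) * var_y + emb a9 * var_x * var_y ^ 2"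
    unfolding total_derivative_y[OF D] S by (simp add: emb_simps algebra_simps power2_eq_square)
  have A: "D X = eval2 ?A X W"
    unfolding X_def W_def total_derivative_inverse[OF D var_x_neq_0] Dx
    by (simp add: emb_simps field_simps power2_eq_square power3_eq_cube)
  have W: "W = 1 - var_y - emb \<alpha> * (1 / var_x)"
    by (simp add: W_def field_simps emb_simps)
  have B: "X * D W = eval2 ?B X W"
    unfolding W X_def total_derivative_diff[OF D] total_derivative_1[OF D] total_derivative_mult[OF D] total_derivative_const[OF D] \<alpha>_def
      total_derivative_inverse[OF D var_x_neq_0] Dx Dy
    by (simp add: emb_simps field_simps power2_eq_square power3_eq_cube)
  note res = accessible_singular_pointD[OF point D, folded \<alpha>_def, folded X_def W_def, OF indep A B]
  from res(2-) show "- a2 - b\<^sub>2 = f"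
    "(2 * a9 + a4 + a2 + b\<^sub>2) * const_t \<alpha>\<^sub>2 - a6 - c = f * m" "2 * a9 + a4 = f * n"
    by (simp_all add: \<alpha>_def)
  from res(1) have "- (a9 + a4) = 0" by simp
  thus "a9 + a4 = 0" by (simp only: neg_equal_0_iff_equal)
qed

section \<open>The system determined by the Painleve scheme\<close>

theorem theorem7p1:
  fixes n\<^sub>1 n\<^sub>2 \<alpha>\<^sub>0 \<alpha>\<^sub>1 \<alpha>\<^sub>2 \<delta> :: complex
    and a :: "nat \<Rightarrow> ratfun"
    and f\<^sub>0 f\<^sub>1 :: ratfun
    and S :: "poly2 \<times> poly2"
  assumes S: "S = system_S a \<alpha>\<^sub>2"
    and mult_0: "multiplicity_two S var_x var_y"
    and point_0: "accessible_singular_point S var_x (var_x^2 * var_y) (- var_t)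
      (f\<^sub>0 \<cdot>\<^sub>m mat_of_rows_list 2 [[1, 0], [const_t (2 * \<alpha>\<^sub>0), const_t n\<^sub>1]])"
    and mult_inf: "multiplicity_two S (1 / var_x)
      (- (var_x * var_y + emb (const_t \<alpha>\<^sub>2)) * var_x)"
    and point_inf: "accessible_singular_point S (1 / var_x)
      (- ((var_x * var_y + emb (const_t \<alpha>\<^sub>2)) / var_x)) (- 1)
      (f\<^sub>1 \<cdot>\<^sub>m mat_of_rows_list 2 [[1, 0], [const_t (2 * \<alpha>\<^sub>1), const_t n\<^sub>2]])"
    and \<delta>: "\<delta> = 4 * \<alpha>\<^sub>0 + 2 * n\<^sub>1 * \<alpha>\<^sub>1 - (n\<^sub>1 + 2) * \<alpha>\<^sub>2"
  shows "pconst (const_t \<delta> * var_t) * fst S =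
      - pconst (const_t (n\<^sub>1 + 2)) * pvar1^2 * pvar2 + 2 * pvar1^2
      + pconst (const_t (2 * (n\<^sub>1 * \<alpha>\<^sub>1 - 2 * \<alpha>\<^sub>2))) * pvar1 - pconst (const_t n\<^sub>1 * var_t)
    \<and> pconst (const_t \<delta> * var_t) * snd S =
      4 * pvar1 * pvar2^2 - 4 * pvar1 * pvar2
      - pconst (const_t (2 * n\<^sub>1 * \<alpha>\<^sub>1 + (n\<^sub>1 - 6) * \<alpha>\<^sub>2)) * pvar2 - pconst (const_t (2 * \<alpha>\<^sub>2))"
proof -
  define t where "t = var_t"
  define n where "n = const_t n\<^sub>1"
  define A\<^sub>0 A\<^sub>1 A\<^sub>2 where "A\<^sub>0 = const_t \<alpha>\<^sub>0" and "A\<^sub>1 = const_t \<alpha>\<^sub>1" and "A\<^sub>2 = const_t \<alpha>\<^sub>2"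
  note defs = t_def[symmetric] n_def[symmetric] A\<^sub>0_def[symmetric] A\<^sub>1_def[symmetric] A\<^sub>2_def[symmetric]
  have t: "t \<noteq> 0" by (simp add: t_def var_t_def)
  note zero_0 = multiplicity_two_at_0[OF S mult_0]
  note zero_inf = multiplicity_two_at_infinity[OF S zero_0 mult_inf]
  define b\<^sub>1 where "b\<^sub>1 = (a 2 + a 9) * A\<^sub>2 - a 6"
  define b\<^sub>2 where "b\<^sub>2 = - a 4 / 2"
  have S_eq: "fst S = [: [:a 8, b\<^sub>1, b\<^sub>2:], [:0, 0, a 2:] :]"
      "snd S = [: [:a 4 * A\<^sub>2 / 2:], [:a 6, a 4:], [:0, a 9:] :]"
    using system_S_eq[OF S refl refl refl] unfolding zero_0 zero_inf b\<^sub>1_def b\<^sub>2_def A\<^sub>2_def by simp_all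
  note pt0 = singular_point_at_0[OF S_eq point_0, unfolded const_t_simps defs]
  note ptinf = singular_point_at_infinity[OF S_eq point_inf, unfolded const_t_simps defs]
  \<comment> \<open>All coefficients become multiples of \<open>a 9\<close>. The factors \<open>2\<close> and \<open>4\<close> keep the equations
    free of denominators.\<close>
  have a4: "a 4 = - a 9" using ptinf(1) by (simp add: eq_neg_iff_add_eq_0 add.commute)
  have b2: "2 * b\<^sub>2 = a 9" by (simp add: b\<^sub>2_def a4)
  define c where "c = a 4 * A\<^sub>2 / 2"
  have c: "2 * c = - a 9 * A\<^sub>2" by (simp add: c_def a4)
  have a8: "2 * a 8 = (2 * a 2 + a 9) * t"
    using pt0(1) t by (simp add: power2_eq_square)
  have f0: "2 * f\<^sub>0 = a 9 * t"
    unfolding pt0(2)[symmetric] using a8 by (simp add: algebra_simps)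
  have "2 * (f\<^sub>0 * n) = - (2 * ((2 * a 2 + a 9) * t))"
    unfolding pt0(4)[symmetric] a8 by (simp add: algebra_simps)
  hence nf0: "n * (2 * f\<^sub>0) = - ((4 * a 2 + 2 * a 9) * t)" by (simp add: algebra_simps)
  have "t * (4 * a 2) = - (n * (2 * f\<^sub>0)) - 2 * (a 9 * t)"
    unfolding nf0 by (simp add: algebra_simps)
  hence "t * (4 * a 2) = t * (- (n + 2) * a 9)" unfolding f0 by (simp add: algebra_simps)
  hence a2: "4 * a 2 = - (n + 2) * a 9" using t by simp
  have "2 * (2 * a 8) = (4 * a 2 + 2 * a 9) * t" unfolding a8 by (simp add: algebra_simps)
  hence a8': "4 * a 8 = - n * t * a 9" unfolding a2 by (simp add: algebra_simps)
  have a6: "a 6 = (2 * a 9 + a 4 + a 2 + b\<^sub>2) * A\<^sub>2 - c + (a 2 + b\<^sub>2) * (2 * A\<^sub>1)"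
    using ptinf(3)[folded c_def] unfolding ptinf(2)[symmetric] by (simp add: algebra_simps)
  have "4 * a 6 = (4 * a 9 + 4 * a 2 + 2 * (2 * b\<^sub>2)) * A\<^sub>2 - 2 * (2 * c)
      + 2 * (4 * a 2 + 2 * (2 * b\<^sub>2)) * A\<^sub>1"
    unfolding a6 a4 by (simp add: algebra_simps)
  hence a6: "4 * a 6 = - (2 * n * A\<^sub>1 + (n - 6) * A\<^sub>2) * a 9"
    unfolding a2 b2 c by (simp add: algebra_simps)
  define d where "d = (4 * A\<^sub>0 + 2 * n * A\<^sub>1 - (n + 2) * A\<^sub>2) * t"
  \<comment> \<open>The inhomogeneous equation: with \<open>f\<^sub>0\<close>, \<open>a 2\<close> and \<open>a 6\<close> eliminated it says that
    \<open>d * a 9 = 4\<close>.\<close>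
  have "(2 * f\<^sub>0) * (4 * A\<^sub>0) = 4 * (1 - t * (2 * b\<^sub>1 + a 6))"
    unfolding pt0(3) by simp
  also have "\<dots> = 4 - t * (2 * (4 * a 2 + 4 * a 9) * A\<^sub>2 - 4 * a 6)"
    unfolding b\<^sub>1_def by (simp add: algebra_simps)
  finally have scale: "(a 9 * t) * (4 * A\<^sub>0) =
      4 - t * (2 * (- (n + 2) * a 9 + 4 * a 9) * A\<^sub>2 - (- (2 * n * A\<^sub>1 + (n - 6) * A\<^sub>2) * a 9))"
    unfolding f0 a2 a6 .
  have "d * a 9 = (a 9 * t) * (4 * A\<^sub>0)
      + t * (2 * (- (n + 2) * a 9 + 4 * a 9) * A\<^sub>2 - (- (2 * n * A\<^sub>1 + (n - 6) * A\<^sub>2) * a 9))"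
    by (simp add: d_def algebra_simps)
  hence d9: "d * a 9 = 4" unfolding scale by simp
  have times_d: "d * u = k" if "4 * u = k * a 9" for u k
  proof -
    have "4 * (d * u) = d * (4 * u)" by simp
    also have "\<dots> = 4 * k" unfolding that using d9 by simp
    finally show ?thesis by simp
  qed
  have d2: "d * a 2 = - (n + 2)" by (rule times_d) (rule a2)
  have d8: "d * a 8 = - n * t" by (rule times_d) (rule a8')
  have d6: "d * a 6 = - (2 * n * A\<^sub>1 + (n - 6) * A\<^sub>2)" by (rule times_d) (rule a6)
  have d4: "d * a 4 = - 4" by (rule times_d) (simp add: a4)
  have db2: "d * b\<^sub>2 = 2" by (rule times_d) (simp flip: b2)
  have dc: "d * c = - 2 * A\<^sub>2" by (rule times_d) (simp add: c_def a4)
  have db1: "d * b\<^sub>1 = 2 * (n * A\<^sub>1 - 2 * A\<^sub>2)"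
  proof -
    have "d * b\<^sub>1 = (d * a 2 + d * a 9) * A\<^sub>2 - d * a 6" by (simp add: b\<^sub>1_def algebra_simps)
    thus ?thesis unfolding d2 d9 d6 by (simp add: algebra_simps)
  qed
  have \<delta>t: "const_t \<delta> * t = d" by (simp add: \<delta> d_def const_t_simps defs)
  have numerals: "(2 :: poly2) = pconst 2" "(4 :: poly2) = pconst 4"
    by (simp_all add: pconst_def numeral_poly)
  have "pconst d * fst S = [: [:- n * t, 2 * (n * A\<^sub>1 - 2 * A\<^sub>2), 2:], [:0, 0, - (n + 2):] :]"
    unfolding S_eq by (simp add: pconst_def d2 d8 db1 db2 del: minus_add_distrib)
  moreover have "pconst d * snd S = [: [:- 2 * A\<^sub>2:], [:- (2 * n * A\<^sub>1 + (n - 6) * A\<^sub>2), - 4:], [:0, 4:] :]"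
    unfolding S_eq c_def[symmetric] by (simp add: pconst_def dc d6 d4 d9 del: minus_add_distrib)
  ultimately show ?thesis
    unfolding const_t_simps defs \<delta>t numerals
    by (simp add: pconst_def pvar1_def pvar2_def power2_eq_square)
qed

end
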